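(* Let $I(n,k)$ be defined as in the context and set $R_n(x)=\sum_{k=0}^{\infty} I(n,k)x^k$ for $n\ge1$. Then, as formal power series in $s$ and $x$, $$\sum_{n=1}^{\infty} R_n(x)\,(sx)^n \;=\; x\log\left(\sum_{n=0}^{\infty}\frac{s^n}{n!}\,e^{xn^2/2}\right).$$
   Context: The numbers $I(n,k)$ are defined recursively by: $I(n,k)=0$ if $k<0$ or $n<1$; $I(1,0)=1$; and for all $n\ge1$, $k\ge0$ with $(n,k)\neq(1,0)$, $$I(n,k)=\frac{1}{2(n+k-1)}\left(n^2 I(n,k-1)+\sum_{i=1}^{n-1}\sum_{j=0}^{k} i(n-i)\,I(i,j)\,I(n-i,k-j)\right).$$ (Combinatorially, $I(n,k)$ is the sum of the inverses of the orders of the automorphism groups of all pairwise non-isomorphic connected multigraphs, loops and multiple edges allowed, on $n$ vertices with cyclomatic number $k$.) *)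

theory Defs
  imports Complex_Main "HOL-Computational_Algebra.Formal_Power_Series"
begin

function conn_mg :: "int \<Rightarrow> int \<Rightarrow> rat" where
  "conn_mg n k =
     (if k < 0 \<or> n < 1 then 0
      else if n = 1 \<and> k = 0 then 1
      else 1 / (2 * (of_int n + of_int k - 1)) *
        (of_int n ^ 2 * conn_mg n (k - 1) +
         (\<Sum>i = 1..n - 1. \<Sum>j = 0..k.
            of_int i * (of_int n - of_int i) * conn_mg i j * conn_mg (n - i) (k - j))))"
  by pat_completeness auto
termination
  by (relation "measures [\<lambda>(n, k). nat n, \<lambda>(n, k). nat (k + 1)]") auto

declare conn_mg.simps [simp del]

definition R_series :: "nat \<Rightarrow> rat fps" where
  "R_series n = Abs_fps (\<lambda>k. conn_mg (int n) (int k))"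

text \<open>
  Formal power series in \<open>s\<close> and \<open>x\<close> are represented as series in \<open>s\<close> whose coefficients
  are series in \<open>x\<close>.
\<close>

definition var_s :: "rat fps fps" where
  "var_s = fps_X"

definition var_x :: "rat fps fps" where
  "var_x = fps_const fps_X"

text \<open>
  The logarithm \<open>log F = (\<Sum>m\<ge>1. (-1)^(m-1) / m * (F - 1)^m)\<close>. The coefficient ring
  \<^typ>\<open>rat fps\<close> is not a field, so \<^const>\<open>fps_ln\<close> only serves to supply the rational
  coefficients \<open>(-1)^(m-1) / m\<close>. As composition with \<open>F - 1\<close> only makes sense if that series
  has no constant term in \<open>s\<close>, the definition is meaningful only if \<open>fps_nth F 0 = 1\<close>.
\<close>

definition biv_log :: "rat fps fps \<Rightarrow> rat fps fps" where
  "biv_log F = fps_compose (Abs_fps (\<lambda>m. fps_const (fps_nth (fps_ln 1) m))) (F - 1)"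

lemma biv_log_nth:
  "fps_nth (biv_log F) n =
     (\<Sum>m = 1..n. fps_const ((-1) ^ (m - 1) / of_nat m) * fps_nth ((F - 1) ^ m) n)"
proof -
  have c: "fps_nth (fps_ln (1::rat)) m = (if m = 0 then 0 else (-1) ^ (m - 1) / of_nat m)" for m
    by (cases m) (simp_all add: fps_ln_def)
  have "fps_nth (biv_log F) n =
      (\<Sum>m = 0..n. fps_const (fps_nth (fps_ln 1) m) * fps_nth ((F - 1) ^ m) n)"
    by (simp add: biv_log_def fps_compose_nth)
  also have "\<dots> = (\<Sum>m = 1..n. fps_const (fps_nth (fps_ln 1) m) * fps_nth ((F - 1) ^ m) n)"
    by (rule sum.mono_neutral_right) (auto simp: c)
  also have "\<dots> = (\<Sum>m = 1..n. fps_const ((-1) ^ (m - 1) / of_nat m) * fps_nth ((F - 1) ^ m) n)"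
    by (rule sum.cong) (auto simp: c)
  finally show ?thesis .
qed

text \<open>The series \<open>\<Sum>n\<ge>0. s^n / n! * e^(x * n^2 / 2)\<close>; \<^term>\<open>fps_exp c\<close> is \<open>e^(c * x)\<close>.\<close>

definition exp_series :: "rat fps fps" where
  "exp_series = Abs_fps (\<lambda>n. fps_const (1 / fact n) * fps_exp (of_nat n ^ 2 / 2))"

lemma exp_series_nth_0: "fps_nth exp_series 0 = 1"
  by (simp add: exp_series_def)

end

theory Submission
  imports Defs
begin

text \<open>
  Write \<open>D = s \<partial>/\<partial>s\<close> and let \<open>F\<close> be the series under the logarithm and \<open>L = log F\<close>. Each summand of
  \<open>F\<close>, and hence \<open>F\<close>, satisfies the heat equation \<open>\<partial>F/\<partial>x = D\<^sup>2 F / 2\<close>. Dividing by \<open>F\<close> turns it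
  into the Riccati equation \<open>\<partial>L/\<partial>x = (D\<^sup>2 L + (D L)\<^sup>2) / 2\<close>, and \<open>L = s\<close> at \<open>x = 0\<close>. On coefficients
  this is a recursion in the \<open>x\<close>-degree with a unique solution, and the substitution
  \<open>[s\<^sup>n x\<^sup>m] L = I(n, m + 1 - n)\<close> transforms it into the recursion defining \<open>I\<close>.
\<close>

section \<open>Partial derivative in x, and derivatives of the logarithm\<close>

text \<open>This plays the role of \<partial>/\<partial>x: the inner series carry x, whereas
  \<open>fps_deriv\<close> on the outer series is \<partial>/\<partial>s.\<close>

definition fps_deriv_coeffs :: "'a::comm_ring_1 fps fps \<Rightarrow> 'a fps fps" where
  "fps_deriv_coeffs A = Abs_fps (\<lambda>n. fps_deriv (fps_nth A n))"

lemma fps_deriv_coeffs_nth [simp]: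
  "fps_nth (fps_deriv_coeffs A) n = fps_deriv (fps_nth A n)"
  by (simp add: fps_deriv_coeffs_def)

lemma fps_deriv_coeffs_mult:
  "fps_deriv_coeffs (A * B) = fps_deriv_coeffs A * B + A * fps_deriv_coeffs B"
  by (rule fps_ext) (simp add: fps_mult_nth fps_deriv_sum sum.distrib add.commute)

lemma fps_deriv_coeffs_one [simp]: "fps_deriv_coeffs 1 = 0"
  by (rule fps_ext) simp

lemma fps_deriv_coeffs_diff:
  "fps_deriv_coeffs (A - B) = fps_deriv_coeffs A - fps_deriv_coeffs B"
  by (rule fps_ext) simp

lemma fps_deriv_coeffs_power:
  "fps_deriv_coeffs (A ^ m) = of_nat m * A ^ (m - 1) * fps_deriv_coeffs A"
proof (induction m)
  case (Suc m)
  then show ?case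
    by (cases m) (simp_all add: fps_deriv_coeffs_mult algebra_simps)
qed simp

text \<open>As \<open>G ^ m\<close> has no terms below degree m, all coefficients of
  \<open>A oo G\<close> up to degree n can use the common range \<open>0..n\<close>, so that the two
  sums can be swapped.\<close>

lemma fps_compose_mult_nth:
  fixes A G H :: "'a::comm_ring_1 fps"
  assumes "fps_nth G 0 = 0"
  shows "fps_nth ((A oo G) * H) n = (\<Sum>m=0..n. fps_nth A m * fps_nth (G ^ m * H) n)"
proof -
  have "fps_nth (A oo G) k = (\<Sum>m=0..n. fps_nth A m * fps_nth (G ^ m) k)" if "k \<le> n" for k
    unfolding fps_compose_nth
    by (rule sum.mono_neutral_left) (use that assms in \<open>auto simp: startsby_zero_power_prefix\<close>)
  then have "fps_nth ((A oo G) * H) n =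
      (\<Sum>k=0..n. \<Sum>m=0..n. fps_nth A m * (fps_nth (G ^ m) k * fps_nth H (n - k)))"
    by (simp add: fps_mult_nth sum_distrib_right mult.assoc)
  also have "\<dots> = (\<Sum>m=0..n. fps_nth A m * fps_nth (G ^ m * H) n)"
    by (subst sum.swap) (simp add: fps_mult_nth sum_distrib_left)
  finally show ?thesis .
qed

text \<open>Chain rule for \<partial>/\<partial>x: the coefficients of \<open>A\<close> are constant
  in x, so only the powers of \<open>G\<close> get differentiated.\<close>

lemma fps_deriv_coeffs_compose:
  fixes G :: "'a::comm_ring_1 fps fps"
  assumes "fps_nth G 0 = 0" and "\<And>m. fps_deriv (fps_nth A m) = 0"
  shows "fps_deriv_coeffs (A oo G) = (fps_deriv A oo G) * fps_deriv_coeffs G"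
proof (rule fps_ext)
  fix n
  let ?f = "\<lambda>m. fps_nth A m * fps_nth (fps_deriv_coeffs (G ^ m)) n"
  \<comment> \<open>\<open>G ^ Suc n\<close> starts at degree \<open>Suc n\<close> in s. The extra
    zero term makes room for the index shift from m to \<open>Suc m\<close>.\<close>
  have top: "?f (Suc n) = 0"
    using assms(1) by (simp add: startsby_zero_power_prefix del: power_Suc)
  have "fps_nth (fps_deriv_coeffs (A oo G)) n = (\<Sum>m=0..n. ?f m)"
    by (simp add: fps_compose_nth fps_deriv_sum assms(2))
  also have "\<dots> = (\<Sum>m=0..Suc n. ?f m)"
    using top by simp
  also have "\<dots> = (\<Sum>m=0..n. ?f (Suc m))"
    by (subst sum.atLeast0_atMost_Suc_shift) simp
  also have "\<dots> = (\<Sum>m=0..n. fps_nth (fps_deriv A) m * fps_nth (G ^ m * fps_deriv_coeffs G) n)"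
  proof (rule sum.cong)
    fix m
    have "fps_nth (of_nat (Suc m) * G ^ m * fps_deriv_coeffs G) n =
        of_nat (Suc m) * fps_nth (G ^ m * fps_deriv_coeffs G) n"
      by (simp only: mult.assoc fps_of_nat [symmetric] fps_mult_left_const_nth)
    then show "?f (Suc m) = fps_nth (fps_deriv A) m * fps_nth (G ^ m * fps_deriv_coeffs G) n"
      unfolding fps_deriv_coeffs_power by (simp add: algebra_simps)
  qed simp
  finally show "fps_nth (fps_deriv_coeffs (A oo G)) n =
      fps_nth ((fps_deriv A oo G) * fps_deriv_coeffs G) n"
    by (simp add: fps_compose_mult_nth assms(1))
qed

text \<open>For A = log (1 + X), composing (1 + X) A' = 1 with \<open>F - 1\<close> shows that A' at
  \<open>F - 1\<close> is the inverse of \<open>F\<close>. Both claims then follow from the chain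
  rules in s and in x.\<close>

lemma biv_log_derivs:
  assumes "fps_nth F 0 = 1"
  shows "F * fps_deriv (biv_log F) = fps_deriv F"
    and "F * fps_deriv_coeffs (biv_log F) = fps_deriv_coeffs F"
proof -
  define A :: "rat fps fps" where "A = Abs_fps (\<lambda>m. fps_const (fps_nth (fps_ln 1) m))"
  define G where "G = F - 1"
  have G0: "fps_nth G 0 = 0"
    using assms by (simp add: G_def)
  have A'_nth: "fps_nth (fps_deriv A) m = fps_const ((- 1) ^ m)" for m
    by (simp add: A_def fps_ln_def fps_of_nat [symmetric] del: of_nat_Suc)
  have "(1 + fps_X) * fps_deriv A = 1"
  proof (rule fps_ext)
    fix m
    show "fps_nth ((1 + fps_X) * fps_deriv A) m = fps_nth 1 m"
      by (cases m) (simp_all add: distrib_right A'_nth del: fps_deriv_nth)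
  qed
  then have "((1 + fps_X) * fps_deriv A) oo G = 1"
    by simp
  then have inv: "F * (fps_deriv A oo G) = 1"
    by (simp add: fps_compose_mult_distrib G0 fps_compose_add_distrib) (simp add: G_def)
  have L: "biv_log F = A oo G"
    by (simp add: biv_log_def A_def G_def)
  have "F * fps_deriv (biv_log F) = (F * (fps_deriv A oo G)) * fps_deriv G"
    by (simp only: L fps_compose_deriv [OF G0] mult.assoc)
  then show "F * fps_deriv (biv_log F) = fps_deriv F"
    by (simp only: inv) (simp add: G_def)
  have "F * fps_deriv_coeffs (biv_log F) = (F * (fps_deriv A oo G)) * fps_deriv_coeffs G"
    by (simp add: L fps_deriv_coeffs_compose G0 A_def mult.assoc)
  then show "F * fps_deriv_coeffs (biv_log F) = fps_deriv_coeffs F"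
    by (simp only: inv) (simp add: G_def fps_deriv_coeffs_diff)
qed

section \<open>Heat equation and Riccati equation\<close>

definition euler_deriv :: "'a::comm_ring_1 fps \<Rightarrow> 'a fps" where
  "euler_deriv A = fps_X * fps_deriv A"

lemma euler_deriv_nth [simp]: "fps_nth (euler_deriv A) n = of_nat n * fps_nth A n"
  by (cases n) (simp_all add: euler_deriv_def)

lemma euler_deriv_mult: "euler_deriv (A * B) = euler_deriv A * B + A * euler_deriv B"
  by (simp add: euler_deriv_def algebra_simps)

lemma exp_series_heat:
  "2 * fps_deriv_coeffs exp_series = euler_deriv (euler_deriv exp_series)"
proof (rule fps_ext)
  fix n
  have sq: "of_nat n * of_nat n = fps_const (of_nat n ^ 2 :: rat)"
    by (simp add: fps_of_nat [symmetric] power2_eq_square)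
  have "fps_nth (2 * fps_deriv_coeffs exp_series) n = 2 * fps_nth (fps_deriv_coeffs exp_series) n"
    by (simp only: numeral_fps_const fps_mult_left_const_nth)
  also have "\<dots> = fps_const (of_nat n ^ 2) * fps_nth exp_series n"
    by (simp add: exp_series_def numeral_fps_const)
  also have "\<dots> = fps_nth (euler_deriv (euler_deriv exp_series)) n"
    by (simp add: sq [symmetric] mult.assoc)
  finally show "fps_nth (2 * fps_deriv_coeffs exp_series) n =
      fps_nth (euler_deriv (euler_deriv exp_series)) n" .
qed

lemma log_exp_series_riccati:
  defines "L \<equiv> biv_log exp_series"
  shows "2 * fps_deriv_coeffs L = euler_deriv (euler_deriv L) + euler_deriv L * euler_deriv L"
proof -
  let ?F = exp_series
  have F0: "?F \<noteq> 0"
    using exp_series_nth_0 by auto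
  note derivs = biv_log_derivs [OF exp_series_nth_0, folded L_def]
  have D: "?F * euler_deriv L = euler_deriv ?F"
    by (simp add: euler_deriv_def derivs(1) [symmetric] algebra_simps)
  have "?F * (2 * fps_deriv_coeffs L) = euler_deriv (euler_deriv ?F)"
    by (simp add: exp_series_heat [symmetric] derivs(2) [symmetric] algebra_simps)
  \<comment> \<open>Apply D to D F = F * D L by the product rule and replace the new D F by F * D L
    once more.\<close>
  also have "\<dots> = ?F * (euler_deriv (euler_deriv L) + euler_deriv L * euler_deriv L)"
    by (simp add: D [symmetric] euler_deriv_mult algebra_simps)
  \<comment> \<open>\<open>F\<close> cancels because \<open>rat fps fps\<close> is an integral
    domain.\<close>
  finally show ?thesis
    using F0 by simp
qed

section \<open>Recursion and initial values for the coefficients of the logarithm\<close>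

lemma log_exp_series_nth_0: "fps_nth (biv_log exp_series) 0 = 0"
  by (simp add: biv_log_nth)

lemma log_exp_series_rec:
  fixes n m :: nat
  defines "l \<equiv> \<lambda>n m. fps_nth (fps_nth (biv_log exp_series) n) m"
  shows "2 * of_nat (Suc m) * l n (Suc m) =
    of_nat n ^ 2 * l n m +
    (\<Sum>i=0..n. \<Sum>p=0..m. of_nat i * of_nat (n - i) * (l i p * l (n - i) (m - p)))"
proof -
  let ?L = "biv_log exp_series"
  have of_nat_nth: "fps_nth (of_nat a * B) m = of_nat a * fps_nth B m" for a m and B :: "rat fps"
    by (simp add: fps_of_nat [symmetric])
  have "fps_nth (2 * fps_deriv_coeffs ?L) n = 2 * fps_deriv (fps_nth ?L n)"
    by (simp add: numeral_fps_const)
  then have "2 * of_nat (Suc m) * l n (Suc m) = fps_nth (fps_nth (2 * fps_deriv_coeffs ?L) n) m"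
    by (simp add: numeral_fps_const l_def algebra_simps)
  also have "\<dots> = of_nat n ^ 2 * l n m +
      (\<Sum>i=0..n. fps_nth ((of_nat i * fps_nth ?L i) * (of_nat (n - i) * fps_nth ?L (n - i))) m)"
    unfolding log_exp_series_riccati
    by (simp add: fps_mult_nth [where f = "euler_deriv ?L"] fps_sum_nth of_nat_nth l_def
        power2_eq_square mult.assoc)
  also have "(\<Sum>i=0..n. fps_nth ((of_nat i * fps_nth ?L i) * (of_nat (n - i) * fps_nth ?L (n - i))) m)
      = (\<Sum>i=0..n. \<Sum>p=0..m. of_nat i * of_nat (n - i) * (l i p * l (n - i) (m - p)))"
    by (simp only: fps_mult_nth [where n = m] of_nat_nth l_def) (simp add: mult_ac)
  finally show ?thesis .
qed

lemma log_exp_series_x0: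
  "fps_nth (fps_nth (biv_log exp_series) n) 0 = (if n = 1 then 1 else 0)"
proof -
  \<comment> \<open>The substitution x = 0. It respects products and \<partial>/\<partial>s and
    sends F to e^s, so F L' = F' becomes e^s L' = e^s.\<close>
  define \<phi> :: "rat fps fps \<Rightarrow> rat fps" where "\<phi> A = Abs_fps (\<lambda>n. fps_nth (fps_nth A n) 0)" for A
  have mult: "\<phi> (A * B) = \<phi> A * \<phi> B" for A B
    by (rule fps_ext) (simp add: \<phi>_def fps_mult_nth fps_sum_nth)
  have deriv: "\<phi> (fps_deriv A) = fps_deriv (\<phi> A)" for A
    by (rule fps_ext) (simp add: \<phi>_def fps_of_nat [symmetric] del: of_nat_Suc)
  have exp: "\<phi> exp_series = fps_exp 1"
    by (rule fps_ext) (simp add: \<phi>_def exp_series_def)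
  have "fps_exp 1 * fps_deriv (\<phi> (biv_log exp_series)) = fps_exp (1::rat) * 1"
    using arg_cong [OF biv_log_derivs(1) [OF exp_series_nth_0], of \<phi>]
    by (simp add: mult deriv exp)
  then have "fps_deriv (\<phi> (biv_log exp_series)) = 1"
    by (metis fps_exp_neq_0 mult_left_cancel)
  then have d: "fps_nth (fps_deriv (\<phi> (biv_log exp_series))) k = (if k = 0 then 1 else 0)" for k
    by simp
  show ?thesis
  proof (cases n)
    case (Suc k)
    then show ?thesis
      using d [of k] by (auto simp: \<phi>_def split: if_splits)
  qed (simp add: log_exp_series_nth_0)
qed

section \<open>The recursion for I, indexed by the x-degree\<close>

lemma conn_mg_neg: "k < 0 \<or> n < 1 \<Longrightarrow> conn_mg n k = 0"
  by (simp add: conn_mg.simps)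

text \<open>Substitute q = p + 1 - i. The terms lost on the left have a negative second argument in
  one factor; i, j \<ge> 1 ensures that every q comes from some p in \<open>0..m\<close>.\<close>

lemma conn_mg_convolution:
  fixes i j m :: nat
  assumes "i \<ge> 1" "j \<ge> 1"
  shows "(\<Sum>p=0..m. conn_mg (int i) (int p + 1 - int i) * conn_mg (int j) (int (m - p) + 1 - int j))
    = (\<Sum>q = 0..int m + 2 - int i - int j.
        conn_mg (int i) q * conn_mg (int j) (int m + 2 - int i - int j - q))"
  by (rule sum.reindex_bij_witness_not_neutral [where
        S' = "{p \<in> {0..m}. int p + 1 < int i \<or> int (m - p) + 1 < int j}" and T' = "{}" and
        j = "\<lambda>p. int p + 1 - int i" and i = "\<lambda>q. nat (q + int i - 1)"])
     (use assms in \<open>auto simp: conn_mg_neg of_nat_diff algebra_simps\<close>)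

text \<open>A connected graph with n vertices and cyclomatic number k has n + k - 1 edges, so the
  index m counts edges. Clearing the denominator 2(n + k - 1) yields the recursion of
  \<open>log_exp_series_rec\<close>.\<close>

lemma conn_mg_rec_shifted:
  fixes n m :: nat
  assumes "n \<ge> 1"
  defines "a \<equiv> \<lambda>(n::nat) (m::nat). conn_mg (int n) (int m + 1 - int n)"
  shows "2 * of_nat (Suc m) * a n (Suc m) =
    of_nat n ^ 2 * a n m +
    (\<Sum>i=0..n. \<Sum>p=0..m. of_nat i * of_nat (n - i) * (a i p * a (n - i) (m - p)))"
proof -
  \<comment> \<open>The cyclomatic number belonging to \<open>Suc m\<close> edges.\<close>
  define k where "k = int m + 2 - int n"
  let ?S = "\<Sum>i=1..int n - 1. \<Sum>j=0..k.
      of_int i * (of_int (int n) - of_int i) * conn_mg i j * conn_mg (int n - i) (k - j)"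
  have "(\<Sum>i=0..n. \<Sum>p=0..m. of_nat i * of_nat (n - i) * (a i p * a (n - i) (m - p)))
      = (\<Sum>i=1..n-1. \<Sum>p=0..m. of_nat i * of_nat (n - i) * (a i p * a (n - i) (m - p)))"
    by (rule sum.mono_neutral_right) (auto simp: not_le simp del: of_nat_diff)
  also have "\<dots> = (\<Sum>i=1..n-1. \<Sum>j=0..k. of_int (int i) * (of_int (int n) - of_int (int i)) *
      conn_mg (int i) j * conn_mg (int n - int i) (k - j))"
  proof (rule sum.cong)
    fix i assume i: "i \<in> {1..n-1}"
    then have le: "i \<le> n" "i \<ge> 1" "n - i \<ge> 1" by auto
    have shift: "int m + 2 - int i - int (n - i) = k" and diff: "int (n - i) = int n - int i"
      using le by (simp_all add: k_def)
    have "(\<Sum>p=0..m. of_nat i * of_nat (n - i) * (a i p * a (n - i) (m - p))) =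
        of_nat i * of_nat (n - i) *
        (\<Sum>p=0..m. conn_mg (int i) (int p + 1 - int i) *
          conn_mg (int (n - i)) (int (m - p) + 1 - int (n - i)))"
      by (simp only: a_def sum_distrib_left)
    also have "\<dots> = of_nat i * of_nat (n - i) *
        (\<Sum>q=0..k. conn_mg (int i) q * conn_mg (int n - int i) (k - q))"
      by (simp only: conn_mg_convolution [OF le(2,3)] shift) (simp only: diff)
    finally show "(\<Sum>p=0..m. of_nat i * of_nat (n - i) * (a i p * a (n - i) (m - p))) =
        (\<Sum>j=0..k. of_int (int i) * (of_int (int n) - of_int (int i)) *
          conn_mg (int i) j * conn_mg (int n - int i) (k - j))"
      using le by (simp add: sum_distrib_left of_nat_diff mult.assoc)
  qed simp
  also have "\<dots> = ?S"
    by (rule sum.reindex_bij_witness [where i = nat and j = int]) (use assms(1) in auto)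
  finally have S: "(\<Sum>i=0..n. \<Sum>p=0..m. of_nat i * of_nat (n - i) * (a i p * a (n - i) (m - p))) = ?S" .
  show ?thesis
  proof (cases "k < 0")
    case True
    then show ?thesis
      unfolding S by (simp add: a_def conn_mg_neg k_def)
  next
    case False
    have aS: "a n (Suc m) = conn_mg (int n) k" and am: "a n m = conn_mg (int n) (k - 1)"
      by (simp_all add: a_def k_def algebra_simps)
    have denom: "2 * (of_int (int n) + of_int k - 1) = (2 * of_nat (Suc m) :: rat)"
      by (simp add: k_def)
    \<comment> \<open>The exceptional pair (1, 0) cannot occur, since n = 1 gives k = m + 1.\<close>
    have "conn_mg (int n) k = 1 / (2 * of_nat (Suc m)) *
        (of_int (int n) ^ 2 * conn_mg (int n) (k - 1) + ?S)"
      using False assms(1) by (subst conn_mg.simps, unfold denom) (auto simp: k_def)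
    then show ?thesis
      unfolding S aS am by (simp add: field_simps del: of_nat_Suc)
  qed
qed

text \<open>Both sides obey the same recursion, which determines x-degree m + 1 from the degrees up
  to m. At degree 0 both are 1 for n = 1 and 0 otherwise.\<close>

lemma log_exp_series_coeff:
  "fps_nth (fps_nth (biv_log exp_series) n) m = conn_mg (int n) (int m + 1 - int n)"
proof (induction m arbitrary: n rule: less_induct)
  case (less m)
  show ?case
  proof (cases m)
    case 0
    have "conn_mg 1 0 = 1"
      by (simp add: conn_mg.simps)
    then show ?thesis
      using 0 by (cases "n = 1") (auto simp: log_exp_series_x0 intro!: conn_mg_neg)
  next
    case (Suc k)
    show ?thesis
    proof (cases "n = 0")
      case False
      then have "n \<ge> 1" by simp
      let ?l = "\<lambda>n m. fps_nth (fps_nth (biv_log exp_series) n) m"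
      let ?a = "\<lambda>(n::nat) (m::nat). conn_mg (int n) (int m + 1 - int n)"
      have IH: "?l n' m' = ?a n' m'" if "m' \<le> k" for n' m'
        using less that Suc by simp
      have "2 * of_nat (Suc k) * ?l n (Suc k) = 2 * of_nat (Suc k) * ?a n (Suc k)"
        unfolding log_exp_series_rec conn_mg_rec_shifted [OF \<open>n \<ge> 1\<close>]
        by (simp add: IH)
      then show ?thesis
        unfolding Suc by (simp del: of_nat_Suc)
    qed (simp add: log_exp_series_nth_0 conn_mg_neg)
  qed
qed

theorem theorem2:
  "fps_compose (Abs_fps (\<lambda>n. if n \<ge> 1 then R_series n else 0)) (var_s * var_x)
     = var_x * biv_log exp_series"
proof (rule fps_ext)
  fix n
  let ?A = "Abs_fps (\<lambda>n. if n \<ge> 1 then R_series n else 0)"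
  have "?A oo (var_s * var_x) = Abs_fps (\<lambda>n. fps_X ^ n * fps_nth ?A n)"
    by (simp only: var_s_def var_x_def mult.commute [of fps_X] fps_compose_linear)
  then have lhs: "fps_nth (?A oo (var_s * var_x)) n = fps_X ^ n * fps_nth ?A n"
    by simp
  have "fps_nth (var_x * biv_log exp_series) n = fps_X * fps_nth (biv_log exp_series) n"
    by (simp add: var_x_def)
  also have "\<dots> = fps_X ^ n * fps_nth ?A n"
  proof (rule fps_ext)
    fix m
    \<comment> \<open>The factor x lowers the index by one, so for m \<ge> 1 the left side is I(n, m
      - n); for m < n both sides vanish.\<close>
    show "fps_nth (fps_X * fps_nth (biv_log exp_series) n) m = fps_nth (fps_X ^ n * fps_nth ?A n) m"
      by (cases "n = 0")
         (auto simp: fps_X_power_mult_nth R_series_def log_exp_series_coeff log_exp_series_nth_0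
           conn_mg_neg of_nat_diff)
  qed
  finally show "fps_nth (?A oo (var_s * var_x)) n = fps_nth (var_x * biv_log exp_series) n"
    by (simp only: lhs)
qed

end
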